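(* (a) If $f:\mathbb{N}\to\mathbb{Z}[q^{\pm1}]$ is $q$-holonomic, then for all $n$ we have $\mathrm{maxdeg}_q(f(n))=O(n^2)$ and $\mathrm{mindeg}_q(f(n))=O(n^2)$. (b) If $f:\mathbb{N}\to\mathbb{Z}[q^{\pm1}]$ is $q$-integral holonomic, then for all $n$ we have $$\|f(n)\|_1\le C^n$$ for some constant $C$. In particular, $$M(f(n))\le C^n$$ and $$\limsup_{n\to\infty}\frac{\log|\mathrm{ev}_{\alpha,n}(f(n))|}{n}\le C$$ for all $\alpha\in\mathbb{R}$.
   Context: A sequence $f:\mathbb{N}\to\mathbb{Q}(q)$ is $q$-holonomic if there exist a natural number $d$ and rational functions $a_j(u,v)\in\mathbb{Q}(u,v)$, $j=0,\dots,d$, with $a_d\ne0$, such that $\sum_{j=0}^d a_j(q^n,q)f(n+j)=0$ for all $n\in\mathbb{N}$. A sequence $f:\mathbb{N}\to\mathbb{Z}[q^{\pm1}]$ is $q$-integral holonomic if it satisfies such an equation with $a_d=1$ and $a_j(u,v)\in\mathbb{Z}[u,v]$ for all $j$. Here $\mathbb{N}$ includes $0$. For a Laurent polynomial $f(q)=\sum_{k=m}^{M}a_kq^k$ with $a_ma_M\ne0$, $\mathrm{maxdeg}_q(f)=M$ and $\mathrm{mindeg}_q(f)=m$. The $l^1$-norm is $\|\sum_kc_kq^k\|_1=\sum_k|c_k|$. The Mahler measure is $M(f)=\exp\int_0^1\log|f(e^{2\pi it})|\,dt$. $\mathrm{ev}_{\alpha,n}(f)$ denotes the evaluation of $f$ at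 $q=e^{2\pi i\alpha/n}$.
   Formalization: The bounds ‖f(n)‖₁ ≤ C^n and M(f(n)) ≤ C^n are stated for n ≥ 1 only, since at n = 0 they fail, for example for the constant sequence f(n) = 5, where 5 > C^0 = 1. *)

theory Defs
  imports
    "HOL-Analysis.Analysis"
    "HOL-Library.Poly_Mapping"
    "HOL-Library.Landau_Symbols"
    "HOL-Computational_Algebra.Computational_Algebra"
    "HOL-Computational_Algebra.Field_as_Ring"
begin

text \<open>
  The group ring of \<^typ>\<open>int\<close> over itself: the finitely supported function \<open>p\<close> stands for the
  sum of \<open>lookup p k * q^k\<close> over \<open>k \<in> keys p\<close>.
\<close>

type_synonym laurent_poly = "int \<Rightarrow>\<^sub>0 int"

text \<open>The degrees of the zero polynomial are not meaningful; they are set to 0 by convention.\<close>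

definition maxdeg :: "laurent_poly \<Rightarrow> int" where
  "maxdeg p = (if p = 0 then 0 else Max (Poly_Mapping.keys p))"

definition mindeg :: "laurent_poly \<Rightarrow> int" where
  "mindeg p = (if p = 0 then 0 else Min (Poly_Mapping.keys p))"

definition l1_norm :: "laurent_poly \<Rightarrow> int" where
  "l1_norm p = (\<Sum>k\<in>Poly_Mapping.keys p. \<bar>Poly_Mapping.lookup p k\<bar>)"

definition laurent_eval :: "laurent_poly \<Rightarrow> 'a::field \<Rightarrow> 'a" where
  "laurent_eval p x = (\<Sum>k\<in>Poly_Mapping.keys p. of_int (Poly_Mapping.lookup p k) * x powi k)"

text \<open>
  For \<open>p \<noteq> 0\<close> the integrand has only finitely many, logarithmic, singularities, so the value
  \<open>ln 0 = 0\<close> there does not affect the integral.  For \<open>p = 0\<close> the integrand is identically minus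
  infinity, whence the value 0.
\<close>

definition mahler_measure :: "laurent_poly \<Rightarrow> real" where
  "mahler_measure p =
     (if p = 0 then 0
      else exp (integral {0..1} (\<lambda>t. ln (norm (laurent_eval p (cis (2 * pi * t)))))))"

definition ev :: "real \<Rightarrow> nat \<Rightarrow> laurent_poly \<Rightarrow> complex" where
  "ev \<alpha> n p = laurent_eval p (cis (2 * pi * \<alpha> / real n))"

definition log_abs :: "complex \<Rightarrow> ereal" where
  "log_abs z = (if z = 0 then - \<infinity> else ereal (ln (norm z)))"

text \<open>
  The field of rational functions in \<open>q\<close> is \<^typ>\<open>rat poly fract\<close>.  The field of rational functions
  in \<open>u, v\<close> is \<^typ>\<open>rat poly poly fract\<close>, where \<open>u\<close> is the outer and \<open>v\<close> the inner polynomial variable.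
\<close>

definition q_var :: "rat poly fract" where
  "q_var = to_fract [:0, 1:]"

definition laurent_to_ratfun :: "laurent_poly \<Rightarrow> rat poly fract" where
  "laurent_to_ratfun p = laurent_eval p q_var"

text \<open>
  The substitution \<open>u = q^n\<close>, \<open>v = q\<close>: the inner variable is just renamed, and
  \<open>monom 1 n\<close> is \<open>q^n\<close>.
\<close>

definition subst_qn :: "nat \<Rightarrow> rat poly poly \<Rightarrow> rat poly" where
  "subst_qn n P = poly P (monom 1 n)"

text \<open>
  Numerator and denominator are taken in lowest terms, so a rational function is declared to be
  defined at \<open>(q^n, q)\<close> iff some representation as a quotient has a non-vanishing denominator there.
\<close>

definition defined_at_qn :: "nat \<Rightarrow> rat poly poly fract \<Rightarrow> bool" where
  "defined_at_qn n r \<longleftrightarrow> subst_qn n (snd (quot_of_fract r)) \<noteq> 0"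

definition eval_qn :: "nat \<Rightarrow> rat poly poly fract \<Rightarrow> rat poly fract" where
  "eval_qn n r =
     to_fract (subst_qn n (fst (quot_of_fract r))) / to_fract (subst_qn n (snd (quot_of_fract r)))"

definition satisfies_q_recurrence ::
  "nat \<Rightarrow> (nat \<Rightarrow> rat poly poly fract) \<Rightarrow> (nat \<Rightarrow> rat poly fract) \<Rightarrow> bool" where
  "satisfies_q_recurrence d a f \<longleftrightarrow>
     (\<forall>n. (\<forall>j\<le>d. defined_at_qn n (a j)) \<and> (\<Sum>j\<le>d. eval_qn n (a j) * f (n + j)) = 0)"

definition q_holonomic :: "(nat \<Rightarrow> rat poly fract) \<Rightarrow> bool" where
  "q_holonomic f \<longleftrightarrow> (\<exists>d a. a d \<noteq> 0 \<and> satisfies_q_recurrence d a f)"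

definition integral_bipolys :: "rat poly poly fract set" where
  "integral_bipolys =
     range (\<lambda>P :: int poly poly. to_fract (map_poly (map_poly rat_of_int) P))"

definition q_integral_holonomic :: "(nat \<Rightarrow> laurent_poly) \<Rightarrow> bool" where
  "q_integral_holonomic f \<longleftrightarrow>
     (\<exists>d a. a d = 1 \<and> (\<forall>j\<le>d. a j \<in> integral_bipolys) \<and>
        satisfies_q_recurrence d a (\<lambda>n. laurent_to_ratfun (f n)))"

end

theory Submission
  imports Defs
begin

text \<open>
  Multiplying a Laurent polynomial by a high power of \<open>q\<close> turns it into an ordinary polynomial,
  and clearing denominators makes the coefficients of the recurrence polynomials in \<open>q^n\<close> and
  \<open>q\<close>.  Their degrees grow linearly in \<open>n\<close>, and the leading one vanishes for finitely many \<open>n\<close>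
  only.  Comparing degrees and orders of vanishing at 0, one step of the recurrence hence widens
  the range of exponents by \<open>O(n)\<close> only, which sums to \<open>O(n^2)\<close>.  The \<open>l\<^sup>1\<close>-norms of the
  coefficients are bounded in \<open>n\<close>, so in the integral case every step multiplies the \<open>l\<^sup>1\<close>-norm
  by at most a constant; this norm dominates the absolute value on the unit circle.
\<close>

section \<open>Polynomials in \<open>q^n\<close> and \<open>q\<close>\<close>

lemma subst_qn_0 [simp]: "subst_qn n 0 = 0"
  and subst_qn_1 [simp]: "subst_qn n 1 = 1"
  and subst_qn_mult: "subst_qn n (P * Q) = subst_qn n P * subst_qn n Q"
  and subst_qn_prod: "subst_qn n (prod g A) = (\<Prod>i\<in>A. subst_qn n (g i))"
  and subst_qn_pCons: "subst_qn n (pCons c P) = c + monom 1 n * subst_qn n P"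
  by (simp_all add: subst_qn_def poly_prod)

text \<open>Horner's scheme: each further power of the outer variable costs one factor
  \<open>q^n\<close>, so the degree grows linearly in \<open>n\<close>. The factor
  \<open>n + 1\<close> covers the part that is constant in \<open>n\<close>.\<close>

lemma degree_subst_qn_le: "\<exists>A. \<forall>n. degree (subst_qn n P) \<le> A * (n + 1)"
proof (induction P)
  case 0
  show ?case by simp
next
  case (pCons c P)
  then obtain A where A: "degree (subst_qn n P) \<le> A * (n + 1)" for n
    by blast
  have "degree (subst_qn n (pCons c P)) \<le> (degree c + A + 1) * (n + 1)" for n
  proof -
    have "degree (monom 1 n * subst_qn n P) \<le> n + A * (n + 1)"
      using degree_mult_le[of "monom 1 n" "subst_qn n P"] degree_monom_le[of 1 n] A[of n]
      by (meson add_mono le_trans)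
    then show ?thesis
      unfolding subst_qn_pCons by (intro degree_add_le) (auto simp: algebra_simps)
  qed
  then show ?case by blast
qed

text \<open>Once \<open>n\<close> exceeds the degree of the lowest coefficient \<open>c\<close>,
  that coefficient cannot cancel the rest, which is a nonzero multiple of
  \<open>q^n\<close>.\<close>

lemma subst_qn_eventually_nonzero:
  assumes "P \<noteq> 0"
  shows "\<exists>n0. \<forall>n\<ge>n0. subst_qn n P \<noteq> 0"
  using assms
proof (induction P)
  case (pCons c P)
  show ?case
  proof (cases "P = 0")
    case True
    with pCons show ?thesis by (auto simp: subst_qn_pCons)
  next
    case False
    with pCons obtain n0 where n0: "subst_qn n P \<noteq> 0" if "n \<ge> n0" for n
      by blast
    have "subst_qn n (pCons c P) \<noteq> 0" if n: "n \<ge> n0 + degree c + 1" for n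
    proof
      assume "subst_qn n (pCons c P) = 0"
      then have "monom 1 n * subst_qn n P = - c"
        by (simp add: subst_qn_pCons eq_neg_iff_add_eq_0 add.commute)
      moreover have "degree (monom 1 n * subst_qn n P) = n + degree (subst_qn n P)"
        using n0[of n] n by (subst degree_mult_eq) (auto simp: degree_monom_eq)
      ultimately show False using n by simp
    qed
    then show ?thesis by blast
  qed
qed simp

section \<open>The l1-norm of ordinary polynomials\<close>

definition poly_l1 :: "'a::linordered_idom poly \<Rightarrow> 'a" where
  "poly_l1 p = (\<Sum>i\<le>degree p. \<bar>coeff p i\<bar>)"

lemma poly_l1_eq_sum:
  assumes "degree p \<le> m"
  shows "poly_l1 p = (\<Sum>i\<le>m. \<bar>coeff p i\<bar>)"
  unfolding poly_l1_def using assms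
  by (intro sum.mono_neutral_left) (auto simp: coeff_eq_0)

lemma poly_l1_nonneg: "poly_l1 p \<ge> 0"
  by (simp add: poly_l1_def sum_nonneg)

lemma poly_l1_0 [simp]: "poly_l1 0 = 0"
  by (simp add: poly_l1_def)

lemma poly_l1_minus [simp]: "poly_l1 (- p) = poly_l1 p"
  by (simp add: poly_l1_def)

lemma poly_l1_add: "poly_l1 (p + q) \<le> poly_l1 p + poly_l1 q"
proof -
  let ?m = "max (degree p) (degree q)"
  have "poly_l1 (p + q) = (\<Sum>i\<le>?m. \<bar>coeff p i + coeff q i\<bar>)"
    using poly_l1_eq_sum[of "p + q" ?m] degree_add_le_max[of p q] by simp
  also have "\<dots> \<le> (\<Sum>i\<le>?m. \<bar>coeff p i\<bar> + \<bar>coeff q i\<bar>)"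
    by (intro sum_mono abs_triangle_ineq)
  also have "\<dots> = poly_l1 p + poly_l1 q"
    using poly_l1_eq_sum[of p ?m] poly_l1_eq_sum[of q ?m] by (simp add: sum.distrib)
  finally show ?thesis .
qed

lemma poly_l1_sum: "poly_l1 (sum g A) \<le> (\<Sum>x\<in>A. poly_l1 (g x))"
  by (induction A rule: infinite_finite_induct)
    (auto intro: order_trans[OF poly_l1_add])

lemma poly_l1_smult: "poly_l1 (smult c p) = \<bar>c\<bar> * poly_l1 p"
  using poly_l1_eq_sum[OF degree_smult_le[of c p]]
  by (simp add: poly_l1_def abs_mult sum_distrib_left)

lemma poly_l1_pCons: "poly_l1 (pCons c p) = \<bar>c\<bar> + poly_l1 p"
proof -
  have "poly_l1 (pCons c p) = (\<Sum>i\<le>Suc (degree p). \<bar>coeff (pCons c p) i\<bar>)"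
    by (rule poly_l1_eq_sum) (rule degree_pCons_le)
  also have "\<dots> = \<bar>c\<bar> + poly_l1 p"
    unfolding poly_l1_def by (subst sum.atMost_Suc_shift) simp
  finally show ?thesis .
qed

text \<open>Split off the constant coefficient of \<open>p\<close>: scaling by it multiplies the
  norm by its absolute value, and the remaining factor of the variable only shifts
  coefficients.\<close>

lemma poly_l1_mult: "poly_l1 (p * q) \<le> poly_l1 p * poly_l1 q"
proof (induction p)
  case (pCons c p)
  have "poly_l1 (pCons c p * q) \<le> poly_l1 (smult c q) + poly_l1 (pCons 0 (p * q))"
    by (simp add: poly_l1_add)
  also have "\<dots> \<le> \<bar>c\<bar> * poly_l1 q + poly_l1 p * poly_l1 q"
    using pCons.IH by (simp add: poly_l1_smult poly_l1_pCons)
  finally show ?case by (simp add: poly_l1_pCons algebra_simps)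
qed simp

lemma poly_l1_monom: "poly_l1 (monom c n) = \<bar>c\<bar>"
  by (induction n) (simp_all add: monom_0 monom_Suc poly_l1_pCons)

text \<open>Multiplication by \<open>q^n\<close> moves coefficients without changing the norm, so
  the bound does not depend on \<open>n\<close>. A natural number \<open>L\<close> lets the later
  estimate return from rationals to integers.\<close>

lemma poly_l1_subst_qn_le: "\<exists>L. \<forall>n. poly_l1 (subst_qn n P) \<le> of_nat L"
proof (induction P)
  case 0
  show ?case by simp
next
  case (pCons c P)
  then obtain L where L: "poly_l1 (subst_qn n P) \<le> of_nat L" for n
    by blast
  obtain K where K: "poly_l1 c \<le> of_nat K"
    using real_arch_simple by blast
  have "poly_l1 (subst_qn n (pCons c P)) \<le> of_nat (K + L)" for n
  proof -
    have "poly_l1 (subst_qn n (pCons c P)) \<le> poly_l1 c + poly_l1 (monom 1 n * subst_qn n P)"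
      unfolding subst_qn_pCons by (rule poly_l1_add)
    also have "\<dots> \<le> poly_l1 c + poly_l1 (subst_qn n P)"
      using poly_l1_mult[of "monom 1 n" "subst_qn n P"] by (simp add: poly_l1_monom)
    also have "\<dots> \<le> of_nat (K + L)"
      using K L[of n] by simp
    finally show ?thesis .
  qed
  then show ?case by blast
qed

section \<open>Laurent polynomials as shifted polynomials\<close>

text \<open>This is \<open>q^N * p\<close>, provided that no exponent lies below \<open>-N\<close>;
  otherwise \<open>nat\<close> would truncate. The coefficients are rational to match those of the
  recurrence.\<close>

definition shift_poly :: "nat \<Rightarrow> laurent_poly \<Rightarrow> rat poly" where
  "shift_poly N p =
     (\<Sum>k\<in>Poly_Mapping.keys p. monom (of_int (Poly_Mapping.lookup p k)) (nat (k + int N)))"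

lemma coeff_shift_poly:
  assumes "\<forall>k\<in>Poly_Mapping.keys p. - int N \<le> k"
  shows "coeff (shift_poly N p) i = of_int (Poly_Mapping.lookup p (int i - int N))"
proof -
  have "coeff (shift_poly N p) i =
      (\<Sum>k\<in>Poly_Mapping.keys p. if k = int i - int N then of_int (Poly_Mapping.lookup p k) else 0)"
    unfolding shift_poly_def coeff_sum
    using assms by (intro sum.cong) force+
  also have "\<dots> = of_int (Poly_Mapping.lookup p (int i - int N))"
    by (simp add: sum.delta in_keys_iff)
  finally show ?thesis .
qed

lemma coeff_shift_poly_nonzero_iff:
  assumes "\<forall>k\<in>Poly_Mapping.keys p. - int N \<le> k"
  shows "coeff (shift_poly N p) i \<noteq> 0 \<longleftrightarrow> int i - int N \<in> Poly_Mapping.keys p"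
  by (simp add: coeff_shift_poly[OF assms] in_keys_iff)

text \<open>The shift is injective on the exponents and preserves the coefficients.\<close>

lemma poly_l1_shift_poly:
  assumes N: "\<forall>k\<in>Poly_Mapping.keys p. - int N \<le> k"
  shows "poly_l1 (shift_poly N p) = of_int (l1_norm p)"
proof -
  let ?S = "(\<lambda>k. nat (k + int N)) ` Poly_Mapping.keys p"
  have inj: "inj_on (\<lambda>k. nat (k + int N)) (Poly_Mapping.keys p)"
  proof (rule inj_onI)
    fix x y
    assume "x \<in> Poly_Mapping.keys p" "y \<in> Poly_Mapping.keys p"
      and eq: "nat (x + int N) = nat (y + int N)"
    then have "- int N \<le> x" "- int N \<le> y" using N by blast+
    with eq show "x = y" by linarith
  qed
  have "i \<in> ?S" if "coeff (shift_poly N p) i \<noteq> 0" for i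
    using that coeff_shift_poly_nonzero_iff[OF N, of i]
    by (intro image_eqI[of _ _ "int i - int N"]) auto
  moreover have "i \<le> degree (shift_poly N p)" if "i \<in> ?S" for i
    using that N coeff_shift_poly_nonzero_iff[OF N, of i] by (intro le_degree) auto
  ultimately have "poly_l1 (shift_poly N p) = (\<Sum>i\<in>?S. \<bar>coeff (shift_poly N p) i\<bar>)"
    unfolding poly_l1_def by (intro sum.mono_neutral_right) auto
  also have "\<dots> = (\<Sum>k\<in>Poly_Mapping.keys p. \<bar>coeff (shift_poly N p) (nat (k + int N))\<bar>)"
    using inj by (simp add: sum.reindex)
  also have "\<dots> = (\<Sum>k\<in>Poly_Mapping.keys p. of_int \<bar>Poly_Mapping.lookup p k\<bar>)"
    using N by (intro sum.cong) (auto simp: coeff_shift_poly[OF N])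
  finally show ?thesis by (simp add: l1_norm_def)
qed

section \<open>Passage between polynomials and the field of rational functions\<close>

lemma to_fract_power: "to_fract (x ^ n) = to_fract x ^ n"
  by (induction n) simp_all

lemma to_fract_of_int: "to_fract (of_int c) = of_int c"
proof -
  have "to_fract (of_nat n) = of_nat n" for n
    by (induction n) simp_all
  then show ?thesis by (cases c) (simp_all del: of_nat_Suc)
qed

lemma to_fract_shift_poly:
  assumes "\<forall>k\<in>Poly_Mapping.keys p. - int N \<le> k"
  shows "to_fract (shift_poly N p) = q_var ^ N * laurent_to_ratfun p"
proof -
  have "to_fract (monom (of_int c) (nat (k + int N))) = q_var ^ N * (of_int c * q_var powi k)"
    if "- int N \<le> k" for c k
  proof -
    have nz: "q_var \<noteq> 0" by (simp add: q_var_def)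
    have "monom (of_int c :: rat) (nat (k + int N)) = of_int c * [:0, 1:] ^ nat (k + int N)"
      by (simp add: monom_altdef of_int_poly)
    then have "to_fract (monom (of_int c) (nat (k + int N))) = of_int c * q_var ^ nat (k + int N)"
      by (simp only: to_fract_mult to_fract_of_int to_fract_power q_var_def)
    also have "q_var ^ nat (k + int N) = q_var powi (k + int N)"
      using that by (simp add: power_int_def)
    also have "\<dots> = q_var powi k * q_var ^ N"
      using nz by (simp add: power_int_add)
    finally show ?thesis by (simp add: mult_ac)
  qed
  then show ?thesis
    unfolding shift_poly_def laurent_to_ratfun_def laurent_eval_def to_fract_sum sum_distrib_left
    using assms by (intro sum.cong) auto
qed

text \<open>With one shift \<open>N\<close> for all terms, \<open>q^N\<close> factors out of the
  relation; injectivity of \<open>to_fract\<close> then brings the relation down to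
  polynomials.\<close>

lemma shift_poly_relation:
  assumes "\<And>j. j \<le> d \<Longrightarrow> \<forall>k\<in>Poly_Mapping.keys (g j). - int N \<le> k"
    and "(\<Sum>j\<le>d. to_fract (c j) * laurent_to_ratfun (g j)) = 0"
  shows "(\<Sum>j\<le>d. c j * shift_poly N (g j)) = 0"
proof -
  have "to_fract (\<Sum>j\<le>d. c j * shift_poly N (g j)) =
      q_var ^ N * (\<Sum>j\<le>d. to_fract (c j) * laurent_to_ratfun (g j))"
    unfolding to_fract_sum sum_distrib_left
    using assms(1) by (intro sum.cong) (simp_all add: to_fract_shift_poly mult_ac)
  then show ?thesis
    unfolding assms(2) by (simp only: mult_zero_right to_fract_eq_0_iff)
qed

lemma exists_common_shift:
  "\<exists>N\<ge>M. \<forall>j\<le>(d::nat). \<forall>k\<in>Poly_Mapping.keys (g j :: laurent_poly). - int N \<le> k"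
proof -
  \<comment> \<open>Only finitely many exponents occur; 0 is inserted so that the maximum
    exists.\<close>
  let ?S = "insert 0 ((\<lambda>k. nat \<bar>k\<bar>) ` (\<Union>j\<le>d. Poly_Mapping.keys (g j)))"
  have "nat \<bar>k\<bar> \<le> Max ?S" if "j \<le> d" "k \<in> Poly_Mapping.keys (g j)" for j k
    using that by (intro Max_ge) auto
  then have "\<forall>j\<le>d. \<forall>k\<in>Poly_Mapping.keys (g j). - int (M + Max ?S) \<le> k"
    by force
  then show ?thesis by (metis le_add1)
qed

section \<open>Growth of the degrees\<close>

text \<open>Isolate \<open>c d * g d\<close>. A product with some \<open>c j\<close> raises the top
  exponent by at most \<open>E\<close> and does not lower the bottom one, while cancelling
  \<open>c d\<close> costs at most its order at 0 at the bottom. So each end of the exponent range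
  moves outwards by at most \<open>E\<close>.\<close>

lemma keys_bound_step:
  fixes g :: "nat \<Rightarrow> laurent_poly"
  assumes rel: "(\<Sum>j\<le>d. to_fract (c j) * laurent_to_ratfun (g j)) = 0"
    and nz: "c d \<noteq> 0"
    and deg: "\<And>j. j \<le> d \<Longrightarrow> degree (c j) \<le> E"
    and keys: "\<And>j k. j < d \<Longrightarrow> k \<in> Poly_Mapping.keys (g j) \<Longrightarrow> \<bar>k\<bar> \<le> int M"
    and k: "k \<in> Poly_Mapping.keys (g d)"
  shows "\<bar>k\<bar> \<le> int (M + E)"
proof -
  obtain N where "N \<ge> M + E" and N: "\<And>j. j \<le> d \<Longrightarrow> \<forall>k\<in>Poly_Mapping.keys (g j). - int N \<le> k"
    using exists_common_shift[of "M + E" d g] by blast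
  define G where "G j = shift_poly N (g j)" for j
  have G_coeff: "coeff (G j) i \<noteq> 0 \<longleftrightarrow> int i - int N \<in> Poly_Mapping.keys (g j)" if "j \<le> d" for i j
    unfolding G_def using coeff_shift_poly_nonzero_iff[OF N[OF that]] .
  have "(\<Sum>j\<le>d. c j * G j) = 0"
    unfolding G_def using N rel by (rule shift_poly_relation)
  then have top: "c d * G d = - (\<Sum>j<d. c j * G j)"
    by (simp add: lessThan_Suc_atMost[symmetric] eq_neg_iff_add_eq_0 add.commute)
  define i where "i = nat (k + int N)"
  have i: "int i = k + int N"
    using N[of d] k by (auto simp: i_def)
  have ci: "coeff (G d) i \<noteq> 0"
    using G_coeff[of d i] k i by simp
  then have "G d \<noteq> 0" by auto
  with nz have prod_nz: "c d * G d \<noteq> 0" by simp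

  \<comment> \<open>Upper end: compare degrees on both sides of \<open>top\<close>.\<close>
  have "degree (G j) \<le> N + M" if "j < d" for j
  proof (rule degree_le, intro allI impI, rule ccontr)
    fix l assume "N + M < l" "coeff (G j) l \<noteq> 0"
    then show False using G_coeff[of j l] keys[of j "int l - int N"] that by auto
  qed
  then have "degree (c j * G j) \<le> E + (N + M)" if "j < d" for j
    using degree_mult_le[of "c j" "G j"] deg[of j] that by (meson add_mono le_trans less_imp_le)
  then have "degree (c d * G d) \<le> E + (N + M)"
    unfolding top degree_minus by (intro degree_sum_le) auto
  then have "i \<le> E + (N + M)"
    using le_degree[OF ci] nz \<open>G d \<noteq> 0\<close> by (simp add: degree_mult_eq)
  \<comment> \<open>Lower end: compare orders of vanishing at 0. The right-hand side of
    \<open>top\<close> is divisible by \<open>q^(N - M)\<close>, the factor \<open>c d\<close>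
    accounts for at most \<open>E\<close> of this order, and the nonzero coefficient at
    \<open>i\<close> bounds the order of \<open>G d\<close>.\<close>
  moreover have "N \<le> i + M + E"
  proof -
    have "monom 1 (N - M) dvd G j" if "j < d" for j
      unfolding monom_1_dvd_iff'
    proof (intro allI impI, rule ccontr)
      fix l assume "l < N - M" "coeff (G j) l \<noteq> 0"
      then show False using G_coeff[of j l] keys[of j "int l - int N"] that by auto
    qed
    then have "monom 1 (N - M) dvd c d * G d"
      unfolding top dvd_minus_iff by (intro dvd_sum dvd_mult) auto
    then have "N - M \<le> order 0 (c d) + order 0 (G d)"
      using prod_nz by (simp add: monom_1_dvd_iff order_mult)
    moreover have "order 0 (c d) \<le> E"
      using order_degree[OF nz, of 0] deg[of d] by simp
    moreover have "order 0 (G d) \<le> i"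
      using ci \<open>G d \<noteq> 0\<close> monom_1_dvd_iff[of "G d" "order 0 (G d)"]
      by (auto simp: monom_1_dvd_iff' not_le[symmetric])
    ultimately show ?thesis by linarith
  qed
  ultimately show ?thesis using i by simp
qed

text \<open>Clear denominators by multiplying with their product. No denominator vanishes at
  \<open>(q^n, q)\<close>, so the cleared equation is the original one times \<open>D\<close> for
  every \<open>n\<close>.\<close>

lemma q_holonomic_imp_polynomial_recurrence:
  assumes "q_holonomic h"
  obtains d P where "P d \<noteq> 0"
    and "\<And>n. (\<Sum>j\<le>d. to_fract (subst_qn n (P j)) * h (n + j)) = 0"
proof -
  from assms obtain d a where a: "a d \<noteq> 0"
    and dfd: "\<And>n j. j \<le> d \<Longrightarrow> defined_at_qn n (a j)"
    and rec: "\<And>n. (\<Sum>j\<le>d. eval_qn n (a j) * h (n + j)) = 0"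
    unfolding q_holonomic_def satisfies_q_recurrence_def by blast
  define num den where "num j = fst (quot_of_fract (a j))"
    and "den j = snd (quot_of_fract (a j))" for j
  define P where "P j = num j * (\<Prod>i\<in>{..d} - {j}. den i)" for j
  have den_nz: "subst_qn n (den j) \<noteq> 0" if "j \<le> d" for n j
    using dfd[OF that] by (simp add: defined_at_qn_def den_def)
  have "num d \<noteq> 0"
    using a by (simp add: num_def)
  moreover have "den j \<noteq> 0" for j
    by (simp add: den_def)
  ultimately have "P d \<noteq> 0"
    by (simp add: P_def)
  moreover have "(\<Sum>j\<le>d. to_fract (subst_qn n (P j)) * h (n + j)) = 0" for n
  proof -
    define D where "D = to_fract (\<Prod>i\<le>d. subst_qn n (den i))"
    have "to_fract (subst_qn n (P j)) = D * eval_qn n (a j)" if "j \<le> d" for j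
    proof -
      have "(\<Prod>i\<le>d. subst_qn n (den i)) =
          subst_qn n (den j) * (\<Prod>i\<in>{..d} - {j}. subst_qn n (den i))"
        using that by (intro prod.remove) auto
      then show ?thesis
        using den_nz[OF that]
        by (simp add: D_def P_def eval_qn_def num_def[symmetric] den_def[symmetric]
            subst_qn_mult subst_qn_prod)
    qed
    then have "(\<Sum>j\<le>d. to_fract (subst_qn n (P j)) * h (n + j)) =
        D * (\<Sum>j\<le>d. eval_qn n (a j) * h (n + j))"
      by (simp add: sum_distrib_left mult.assoc)
    then show ?thesis using rec by simp
  qed
  ultimately show ?thesis using that by blast
qed

text \<open>Beyond an initial stretch, the exponent range for index \<open>m\<close> widens by at
  most \<open>B * (m + 1)\<close> per step, and these increments sum to a quadratic bound.\<close>

lemma q_holonomic_keys_bound: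
  fixes f :: "nat \<Rightarrow> laurent_poly"
  assumes "q_holonomic (\<lambda>n. laurent_to_ratfun (f n))"
  obtains K A where "\<And>m k. k \<in> Poly_Mapping.keys (f m) \<Longrightarrow> \<bar>k\<bar> \<le> int (K + A * (m + 1) * (m + 1))"
proof -
  obtain P d where P: "P d \<noteq> 0"
    and rec: "\<And>n. (\<Sum>j\<le>d. to_fract (subst_qn n (P j)) * laurent_to_ratfun (f (n + j))) = 0"
    by (rule q_holonomic_imp_polynomial_recurrence[OF assms]) (rule that)
  obtain n0 where n0: "\<And>n. n \<ge> n0 \<Longrightarrow> subst_qn n (P d) \<noteq> 0"
    using subst_qn_eventually_nonzero[OF P] by blast
  have "\<forall>j. \<exists>A. \<forall>n. degree (subst_qn n (P j)) \<le> A * (n + 1)"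
    by (intro allI degree_subst_qn_le)
  then have "\<exists>A. \<forall>j n. degree (subst_qn n (P j)) \<le> A j * (n + 1)"
    by (rule choice)
  then obtain A where A: "\<And>j n. degree (subst_qn n (P j)) \<le> A j * (n + 1)"
    by blast
  define B where "B = (\<Sum>j\<le>d. A j)"
  have B: "degree (subst_qn n (P j)) \<le> B * (n + 1)" if "j \<le> d" for n j
    using A[of n j] mult_le_mono1[of "A j" B "n + 1"] member_le_sum[of j "{..d}" A] that
    by (auto simp: B_def)
  \<comment> \<open>\<open>K\<close> covers all indices up to \<open>n0 + d\<close>; beyond them,
    the recurrence is used at \<open>n = m - d\<close>, where \<open>n \<ge> n0\<close> makes the
    leading coefficient nonzero.\<close>
  let ?S = "insert 0 ((\<lambda>k. nat \<bar>k\<bar>) ` (\<Union>m\<le>n0 + d. Poly_Mapping.keys (f m)))"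
  define K where "K = Max ?S"
  have K: "\<bar>k\<bar> \<le> int K" if "m \<le> n0 + d" "k \<in> Poly_Mapping.keys (f m)" for k m
  proof -
    have "nat \<bar>k\<bar> \<le> K"
      unfolding K_def using that by (intro Max_ge) auto
    then show ?thesis by linarith
  qed
  have "\<bar>k\<bar> \<le> int (K + B * (m + 1) * (m + 1))" if "k \<in> Poly_Mapping.keys (f m)" for k m
    using that
  proof (induction m arbitrary: k rule: less_induct)
    case (less m)
    show ?case
    proof (cases "m \<le> n0 + d")
      case True
      have "int K \<le> int (K + B * (m + 1) * (m + 1))"
        unfolding of_nat_le_iff by simp
      then show ?thesis using K[OF True less.prems] by linarith
    next
      case False
      define n where "n = m - d"
      have n: "n \<ge> n0" "m = n + d"
        using False by (simp_all add: n_def)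
      \<comment> \<open>Since \<open>n + j + 1 \<le> m\<close>, one of the two factors can be kept
        as \<open>m\<close>; the increment \<open>B * (m + 1)\<close> then completes
        \<open>(m + 1) * (m + 1)\<close>.\<close>
      have "\<bar>l\<bar> \<le> int (K + B * (m + 1) * m)" if "j < d" "l \<in> Poly_Mapping.keys (f (n + j))" for j l
      proof -
        have "\<bar>l\<bar> \<le> int (K + B * (n + j + 1) * (n + j + 1))"
          using less.IH[of "n + j" l] that n by simp
        also have "\<dots> \<le> int (K + B * (m + 1) * m)"
          unfolding of_nat_le_iff using that n by (intro add_left_mono mult_le_mono) auto
        finally show ?thesis .
      qed
      moreover have "degree (subst_qn n (P j)) \<le> B * (m + 1)" if "j \<le> d" for j
        using B[OF that, of n] mult_le_mono2[of "n + 1" "m + 1" B] n by linarith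
      ultimately have "\<bar>k\<bar> \<le> int (K + B * (m + 1) * m + B * (m + 1))"
        using keys_bound_step[where d = d and c = "\<lambda>j. subst_qn n (P j)" and g = "\<lambda>j. f (n + j)"
            and E = "B * (m + 1)" and M = "K + B * (m + 1) * m" and k = k] rec[of n] n0[of n] n less.prems
        by blast
      then show ?thesis by (simp add: algebra_simps)
    qed
  qed
  then show ?thesis using that by blast
qed

lemma keys_bound_imp_bigo:
  fixes h :: "nat \<Rightarrow> int"
  assumes "\<And>m. \<bar>h m\<bar> \<le> int (K + A * (m + 1) * (m + 1))"
  shows "(\<lambda>n. real_of_int (h n)) \<in> O(\<lambda>n. real n ^ 2)"
\<comment> \<open>For \<open>n \<ge> 1\<close>, \<open>n + 1 \<le> 2 * n\<close> gives the factor 4,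
  and \<open>K \<le> K * n ^ 2\<close>.\<close>
proof (rule bigoI[where c = "real (K + 4 * A)"])
  show "\<forall>\<^sub>F n in sequentially. norm (real_of_int (h n)) \<le> real (K + 4 * A) * norm (real n ^ 2)"
    using eventually_ge_at_top[of 1]
  proof eventually_elim
    case (elim n)
    have "A * (n + 1) * (n + 1) \<le> A * (2 * n) * (2 * n)"
      using elim by (intro mult_le_mono) auto
    moreover have "K \<le> K * n ^ 2"
      using elim by simp
    ultimately have "K + A * (n + 1) * (n + 1) \<le> K * n ^ 2 + A * (2 * n) * (2 * n)"
      by (intro add_mono)
    also have "\<dots> = (K + 4 * A) * n ^ 2"
      by (simp add: algebra_simps power2_eq_square)
    finally have "\<bar>h n\<bar> \<le> int ((K + 4 * A) * n ^ 2)"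
      using assms[of n] by linarith
    then have "real_of_int \<bar>h n\<bar> \<le> real_of_int (int ((K + 4 * A) * n ^ 2))"
      by (simp only: of_int_le_iff)
    then show ?case by simp
  qed
qed

section \<open>Growth of the norms\<close>

text \<open>As the leading coefficient is 1, the last term is isolated without division; the
  triangle inequality and submultiplicativity of the norm do the rest.\<close>

lemma l1_norm_step:
  fixes g :: "nat \<Rightarrow> laurent_poly"
  assumes rel: "(\<Sum>j\<le>d. to_fract (c j) * laurent_to_ratfun (g j)) = 0"
    and "c d = 1"
    and L: "\<And>j. j < d \<Longrightarrow> poly_l1 (c j) \<le> of_nat L"
  shows "l1_norm (g d) \<le> int L * (\<Sum>j<d. l1_norm (g j))"
proof -
  obtain N where N: "\<And>j. j \<le> d \<Longrightarrow> \<forall>k\<in>Poly_Mapping.keys (g j). - int N \<le> k"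
    using exists_common_shift[of 0 d g] by blast
  define G where "G j = shift_poly N (g j)" for j
  have l1: "poly_l1 (G j) = of_int (l1_norm (g j))" if "j \<le> d" for j
    unfolding G_def using N[OF that] by (rule poly_l1_shift_poly)
  have "(\<Sum>j\<le>d. c j * G j) = 0"
    unfolding G_def using N rel by (rule shift_poly_relation)
  then have "G d = - (\<Sum>j<d. c j * G j)"
    using \<open>c d = 1\<close> by (simp add: lessThan_Suc_atMost[symmetric] eq_neg_iff_add_eq_0 add.commute)
  then have "poly_l1 (G d) \<le> (\<Sum>j<d. poly_l1 (c j * G j))"
    by (simp add: poly_l1_sum)
  also have "\<dots> \<le> (\<Sum>j<d. of_nat L * poly_l1 (G j))"
    using L by (intro sum_mono order_trans[OF poly_l1_mult] mult_right_mono poly_l1_nonneg) auto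
  also have "\<dots> = of_int (int L * (\<Sum>j<d. l1_norm (g j)))"
    by (simp add: l1 sum_distrib_left)
  finally have "(of_int (l1_norm (g d)) :: rat) \<le> of_int (int L * (\<Sum>j<d. l1_norm (g j)))"
    by (simp add: l1)
  then show ?thesis by (simp only: of_int_le_iff)
qed

lemma l1_norm_nonneg: "l1_norm p \<ge> 0"
  by (simp add: l1_norm_def sum_nonneg)

text \<open>A nonzero integer coefficient has absolute value at least 1. This makes the logarithm of
  the norm nonnegative.\<close>

lemma l1_norm_ge_1:
  assumes "p \<noteq> 0"
  shows "l1_norm p \<ge> 1"
proof -
  obtain k where k: "k \<in> Poly_Mapping.keys p"
    using assms by (auto simp: keys_eq_empty[symmetric] simp del: keys_eq_empty)
  then have "1 \<le> \<bar>Poly_Mapping.lookup p k\<bar>"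
    by (simp add: in_keys_iff)
  also have "\<dots> \<le> l1_norm p"
    unfolding l1_norm_def using k by (intro member_le_sum) auto
  finally show ?thesis .
qed

lemma q_integral_holonomic_l1_norm_recurrence:
  assumes "q_integral_holonomic f"
  obtains d L where "\<And>n. l1_norm (f (n + d)) \<le> int L * (\<Sum>j<d. l1_norm (f (n + j)))"
proof -
  from assms obtain d a where a: "a d = 1" "\<And>j. j \<le> d \<Longrightarrow> a j \<in> integral_bipolys"
    and rec: "\<And>n. (\<Sum>j\<le>d. eval_qn n (a j) * laurent_to_ratfun (f (n + j))) = 0"
    unfolding q_integral_holonomic_def satisfies_q_recurrence_def by blast
  \<comment> \<open>Each \<open>a j\<close> is a polynomial, so in lowest terms its denominator is 1
    and evaluation is plain substitution into the numerator.\<close>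
  define P where "P j = fst (quot_of_fract (a j))" for j
  have aP: "a j = to_fract (P j)" if "j \<le> d" for j
    using a(2)[OF that] by (auto simp: integral_bipolys_def P_def)
  have ev: "eval_qn n (a j) = to_fract (subst_qn n (P j))" if "j \<le> d" for n j
    by (simp add: eval_qn_def aP[OF that])
  have "P d = 1"
    using a(1) aP[of d] by (metis order_refl to_fract_1 to_fract_eq_iff)
  have "\<forall>j. \<exists>L. \<forall>n. poly_l1 (subst_qn n (P j)) \<le> of_nat L"
    by (intro allI poly_l1_subst_qn_le)
  then have "\<exists>L. \<forall>j n. poly_l1 (subst_qn n (P j)) \<le> of_nat (L j)"
    by (rule choice)
  then obtain L where L: "\<And>j n. poly_l1 (subst_qn n (P j)) \<le> of_nat (L j)"
    by blast
  have "poly_l1 (subst_qn n (P j)) \<le> of_nat (\<Sum>j<d. L j)" if "j < d" for n j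
  proof -
    have "L j \<le> (\<Sum>j<d. L j)"
      using that by (intro member_le_sum) auto
    then show ?thesis using L[of n j] by (meson of_nat_mono order_trans)
  qed
  moreover have "(\<Sum>j\<le>d. to_fract (subst_qn n (P j)) * laurent_to_ratfun (f (n + j))) = 0" for n
    using rec[of n] by (simp add: ev)
  ultimately have "l1_norm (f (n + d)) \<le> int (\<Sum>j<d. L j) * (\<Sum>j<d. l1_norm (f (n + j)))" for n
    using \<open>P d = 1\<close>
    by (intro l1_norm_step[where c = "\<lambda>j. subst_qn n (P j)" and g = "\<lambda>j. f (n + j)"]) auto
  then show ?thesis using that by blast
qed

text \<open>\<open>K\<close> bounds the initial values, and one step multiplies the running bound by
  at most \<open>d * L\<close>. The summand 1 in \<open>R\<close> makes its powers
  nondecreasing.\<close>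

lemma geometric_bound_of_linear_recurrence:
  fixes u :: "nat \<Rightarrow> int"
  assumes rec: "\<And>n. u (n + d) \<le> int L * (\<Sum>j<d. u (n + j))"
  obtains C :: nat where "C \<ge> 1" "\<And>n. n \<ge> 1 \<Longrightarrow> u n \<le> int C ^ n"
proof -
  define K where "K = Max (insert 1 ((\<lambda>i. nat (u i)) ` {..<d}))"
  define R where "R = d * L + 1"
  have K1: "K \<ge> 1"
    unfolding K_def by (intro Max_ge) auto
  have K: "u i \<le> int K" if "i < d" for i
  proof -
    have "nat (u i) \<le> K"
      unfolding K_def using that by (intro Max_ge) auto
    then show ?thesis by linarith
  qed
  have bound: "u m \<le> int (K * R ^ m)" for m
  proof (induction m rule: less_induct)
    case (less m)
    show ?case
    proof (cases "m < d")
      case True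
      have "u m \<le> int K" using K[OF True] .
      also have "\<dots> \<le> int (K * R ^ m)"
        unfolding of_nat_le_iff by (simp add: R_def)
      finally show ?thesis .
    next
      case False
      define n where "n = m - d"
      have m: "m = n + d" using False by (simp add: n_def)
      have "u (n + j) \<le> int (K * R ^ (m - 1))" if "j < d" for j
      proof -
        have "u (n + j) \<le> int (K * R ^ (n + j))"
          using less.IH[of "n + j"] that m by simp
        also have "\<dots> \<le> int (K * R ^ (m - 1))"
          unfolding of_nat_le_iff using that m
          by (intro mult_le_mono2 power_increasing) (auto simp: R_def)
        finally show ?thesis .
      qed
      then have "(\<Sum>j<d. u (n + j)) \<le> int d * int (K * R ^ (m - 1))"
        using sum_bounded_above[of "{..<d}" "\<lambda>j. u (n + j)"] by simp
      then have "u m \<le> int L * (int d * int (K * R ^ (m - 1)))"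
        using rec[of n] m by (meson mult_left_mono of_nat_0_le_iff order_trans)
      also have "\<dots> = int ((d * L) * (K * R ^ (m - 1)))"
        by simp
      also have "\<dots> \<le> int (K * R ^ m)"
      \<comment> \<open>For \<open>d = 0\<close> the left-hand side is 0; for \<open>d > 0\<close>
        also \<open>m > 0\<close>, so \<open>m - 1\<close> is a true predecessor.\<close>
      proof (cases "d = 0")
        case False
        then have "R ^ m = R * R ^ (m - 1)"
          using m by (simp add: power_eq_if)
        then show ?thesis
          unfolding of_nat_le_iff by (simp add: R_def)
      qed simp
      finally show ?thesis .
    qed
  qed
  have "u n \<le> int (K * R) ^ n" if "n \<ge> 1" for n
  proof -
    \<comment> \<open>The factor \<open>K\<close> is absorbed into the base. This works from
      \<open>n = 1\<close> on; at \<open>n = 0\<close> the power would be 1, whatever the initial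
      value.\<close>
    have "K \<le> K ^ n"
      using K1 that self_le_power[of K n] by simp
    then have "K * R ^ n \<le> (K * R) ^ n"
      by (simp add: power_mult_distrib)
    then have "int (K * R ^ n) \<le> int (K * R) ^ n"
      by (metis of_nat_le_iff of_nat_power)
    then show ?thesis using bound[of n] by linarith
  qed
  moreover have "K * R \<ge> 1"
    using K1 by (simp add: R_def)
  ultimately show ?thesis using that by blast
qed

section \<open>Evaluation on the unit circle and the Mahler measure\<close>

lemma norm_laurent_eval_le_l1_norm:
  fixes z :: complex
  assumes "norm z = 1"
  shows "norm (laurent_eval p z) \<le> real_of_int (l1_norm p)"
proof -
  have "norm (laurent_eval p z) \<le>
      (\<Sum>k\<in>Poly_Mapping.keys p. norm (of_int (Poly_Mapping.lookup p k) * z powi k))"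
    unfolding laurent_eval_def by (rule norm_sum)
  also have "\<dots> = real_of_int (l1_norm p)"
    by (simp add: l1_norm_def norm_mult norm_power_int assms)
  finally show ?thesis .
qed

text \<open>
  No integrability is needed: for a non-integrable integrand the integral is 0 by convention, and
  a nonzero integral Laurent polynomial has norm at least 1.
\<close>

lemma mahler_measure_le_l1_norm: "mahler_measure p \<le> real_of_int (l1_norm p)"
proof (cases "p = 0")
  case True
  then show ?thesis by (simp add: mahler_measure_def l1_norm_nonneg)
next
  case False
  let ?F = "\<lambda>t. ln (norm (laurent_eval p (cis (2 * pi * t))))"
  have l1: "real_of_int (l1_norm p) \<ge> 1"
    using l1_norm_ge_1[OF False] by simp
  have "?F t \<le> ln (real_of_int (l1_norm p))" for t
  \<comment> \<open>At a zero of \<open>p\<close> the integrand takes the default value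
    \<open>ln 0 = 0\<close>, which \<open>l1\<close> keeps below the bound.\<close>
  proof (cases "laurent_eval p (cis (2 * pi * t)) = 0")
    case False
    then show ?thesis
      using norm_laurent_eval_le_l1_norm[of "cis (2 * pi * t)" p] l1 by simp
  qed (use l1 in simp)
  then have "integral {0..1} ?F \<le> ln (real_of_int (l1_norm p))"
  proof (cases "?F integrable_on {0..1}")
    case True
    then have "integral {0..1} ?F \<le> integral {0..1} (\<lambda>t::real. ln (real_of_int (l1_norm p)))"
      using \<open>\<And>t. ?F t \<le> _\<close> by (intro integral_le) auto
    then show ?thesis by simp
  qed (use l1 in \<open>simp add: not_integrable_integral\<close>)
  then have "exp (integral {0..1} ?F) \<le> exp (ln (real_of_int (l1_norm p)))"
    by simp
  then show ?thesis
    using False l1 by (simp add: mahler_measure_def)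
qed

lemma limsup_log_abs_ev_le:
  fixes C :: real
  assumes C: "C \<ge> 1" and l1: "\<And>n. n \<ge> 1 \<Longrightarrow> real_of_int (l1_norm (f n)) \<le> C ^ n"
  shows "limsup (\<lambda>n. log_abs (ev \<alpha> n (f n)) / ereal (real n)) \<le> ereal C"
proof (rule Limsup_bounded)
  show "\<forall>\<^sub>F n in sequentially. log_abs (ev \<alpha> n (f n)) / ereal (real n) \<le> ereal C"
    using eventually_ge_at_top[of 1]
  proof eventually_elim
    case (elim n)
    show ?case
    \<comment> \<open>A vanishing evaluation contributes minus infinity, which stays so after
      division by \<open>n \<ge> 1\<close>.\<close>
    proof (cases "ev \<alpha> n (f n) = 0")
      case True
      then show ?thesis using elim by (simp add: log_abs_def)
    next
      case False
      have "norm (ev \<alpha> n (f n)) \<le> C ^ n"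
        unfolding ev_def using l1[OF elim]
        by (intro order_trans[OF norm_laurent_eval_le_l1_norm]) simp_all
      then have "ln (norm (ev \<alpha> n (f n))) \<le> ln (C ^ n)"
        using False C by simp
      also have "\<dots> = real n * ln C"
        using C by (simp add: ln_realpow)
      also have "\<dots> \<le> real n * C"
        \<comment> \<open>The natural rate is \<open>ln C\<close>; weakening it to \<open>C\<close>
          lets the constant of the norm bound serve here too.\<close>
        using C ln_le_minus_one[of C] by (intro mult_left_mono) auto
      finally have "ln (norm (ev \<alpha> n (f n))) / real n \<le> C"
        using elim by (simp add: field_simps)
      then show ?thesis using False elim by (simp add: log_abs_def)
    qed
  qed
qed

theorem theorem10:
  fixes f :: "nat \<Rightarrow> laurent_poly"
  shows
    "(q_holonomic (\<lambda>n. laurent_to_ratfun (f n)) \<longrightarrow>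
        (\<lambda>n. real_of_int (maxdeg (f n))) \<in> O(\<lambda>n. real n ^ 2) \<and>
        (\<lambda>n. real_of_int (mindeg (f n))) \<in> O(\<lambda>n. real n ^ 2)) \<and>
     (q_integral_holonomic f \<longrightarrow>
        (\<exists>C::real.
           (\<forall>n\<ge>1. real_of_int (l1_norm (f n)) \<le> C ^ n) \<and>
           (\<forall>n\<ge>1. mahler_measure (f n) \<le> C ^ n) \<and>
           (\<forall>\<alpha>::real. limsup (\<lambda>n. log_abs (ev \<alpha> n (f n)) / ereal (real n)) \<le> ereal C)))"
proof (intro conjI impI)
  assume "q_holonomic (\<lambda>n. laurent_to_ratfun (f n))"
  then obtain K A where
    *: "\<And>m k. k \<in> Poly_Mapping.keys (f m) \<Longrightarrow> \<bar>k\<bar> \<le> int (K + A * (m + 1) * (m + 1))"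
    using q_holonomic_keys_bound by blast
  \<comment> \<open>The degree of a nonzero polynomial is one of its exponents; for 0 the
    conventional value 0 satisfies the bound.\<close>
  have "\<bar>maxdeg (f m)\<bar> \<le> int (K + A * (m + 1) * (m + 1))" for m
    using *[of "Max (Poly_Mapping.keys (f m))" m] by (cases "f m = 0") (simp_all add: maxdeg_def)
  then show "(\<lambda>n. real_of_int (maxdeg (f n))) \<in> O(\<lambda>n. real n ^ 2)"
    by (rule keys_bound_imp_bigo)
  have "\<bar>mindeg (f m)\<bar> \<le> int (K + A * (m + 1) * (m + 1))" for m
    using *[of "Min (Poly_Mapping.keys (f m))" m] by (cases "f m = 0") (simp_all add: mindeg_def)
  then show "(\<lambda>n. real_of_int (mindeg (f n))) \<in> O(\<lambda>n. real n ^ 2)"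
    by (rule keys_bound_imp_bigo)
next
  assume "q_integral_holonomic f"
  then obtain d L where "\<And>n. l1_norm (f (n + d)) \<le> int L * (\<Sum>j<d. l1_norm (f (n + j)))"
    using q_integral_holonomic_l1_norm_recurrence by blast
  then obtain C :: nat where "C \<ge> 1" and C: "\<And>n. n \<ge> 1 \<Longrightarrow> l1_norm (f n) \<le> int C ^ n"
    using geometric_bound_of_linear_recurrence[of "\<lambda>n. l1_norm (f n)" d L] by blast
  have l1: "real_of_int (l1_norm (f n)) \<le> real C ^ n" if "n \<ge> 1" for n
  proof -
    have "real_of_int (l1_norm (f n)) \<le> real_of_int (int C ^ n)"
      using C[OF that] by (simp only: of_int_le_iff)
    then show ?thesis by simp
  qed
  show "\<exists>C::real.
           (\<forall>n\<ge>1. real_of_int (l1_norm (f n)) \<le> C ^ n) \<and>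
           (\<forall>n\<ge>1. mahler_measure (f n) \<le> C ^ n) \<and>
           (\<forall>\<alpha>::real. limsup (\<lambda>n. log_abs (ev \<alpha> n (f n)) / ereal (real n)) \<le> ereal C)"
  proof (intro exI[of _ "real C"] conjI allI impI)
    fix n :: nat assume "n \<ge> 1"
    then show "mahler_measure (f n) \<le> real C ^ n"
      using mahler_measure_le_l1_norm[of "f n"] l1[of n] by linarith
  next
    fix \<alpha> :: real
    show "limsup (\<lambda>n. log_abs (ev \<alpha> n (f n)) / ereal (real n)) \<le> ereal (real C)"
      using \<open>C \<ge> 1\<close> l1 by (intro limsup_log_abs_ev_le) auto
  qed (use l1 in blast)
qed

end
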